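(* Let $\mathcal{G}$ be an undirected, connected, weighted graph with $N$ vertices, let $\hat g:[0,\lambda_{\max}]\to\mathbb{R}$ be a kernel, and let $i,n\in\{1,\dots,N\}$. Put $d_{in}:=d_{\mathcal{G}}(i,n)$ and $K_{in}:=d_{in}-1$. Then $$|(T_i g)(n)|\le \sqrt{N}\,\inf_{\widehat{p_{K_{in}}}}\Big\{\sup_{\lambda\in[0,\lambda_{\max}]}\big|\hat g(\lambda)-\widehat{p_{K_{in}}}(\lambda)\big|\Big\}=\sqrt N\,\inf_{\widehat{p_{K_{in}}}}\big\{\|\hat g-\widehat{p_{K_{in}}}\|_\infty\big\},$$ where the infimum is over all polynomial kernels $\widehat{p_{K_{in}}}(\lambda)=\sum_{k=0}^{K_{in}}a_k\lambda^k$ with real coefficients $a_k$. More generally, for $p,q\ge 1$ with $\frac1p+\frac1q=1$, $$|(T_i g)(n)|\le \sqrt{N}\,\mu^{\frac{2(q-1)}{q}}\,\inf_{\widehat{p_{K_{in}}}}\big\{\|\hat g-\widehat{p_{K_{in}}}\|_p\big\}.$$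
   Context: Setting: $\mathcal{G}=\{\mathcal{V},\mathcal{E},W\}$ is a finite undirected, connected, weighted graph with vertices $\{1,\dots,N\}$, where $W$ is a symmetric weighted adjacency matrix (non-negative entries, zero diagonal, $W_{mn}>0$ iff $(m,n)\in\mathcal{E}$). $D$ is the diagonal matrix of degrees $d_n=\sum_{m\ne n}W_{mn}$ and $\mathcal{L}=D-W$ is the graph Laplacian. $\{\chi_\ell\}_{\ell=0,\dots,N-1}$ is a fixed orthonormal basis of eigenvectors of $\mathcal{L}$ (possibly complex-valued) with eigenvalues $0=\lambda_0<\lambda_1\le\dots\le\lambda_{N-1}=:\lambda_{\max}$, and $\chi_0(n)=1/\sqrt N$ for all $n$. A superscript $*$ on a scalar denotes complex conjugation. The coherence is $\mu:=\max_{\ell,i}|\chi_\ell(i)|$. A kernel $\hat g:[0,\lambda_{\max}]\to\mathbb{R}$ defines the signal $g(n)=\sum_{\ell=0}^{N-1}\hat g(\lambda_\ell)\chi_\ell(n)$. The generalized translation to vertex $i$ is $(T_i g)(n):=\sqrt N\sum_{\ell=0}^{N-1}\hat g(\lambda_\ell)\chi_\ell^*(i)\chi_\ell(n)$. The distance $d_{\mathcal{G}}(i,n)$ is the minimum number of edges in a path connecting $i$ and $n$ (weights are ignored). Conventions: $\|\cdot\|_\infty$ is the supremum over $[0,\lambda_{\max}]$; for $1\le p<\infty$, $\|\hat h\|_p:=\big(\sum_{\ell=0}^{N-1}|\hat h(\lambda_\ell)|^p\big)^{1/p}$. The pairs $(p,q)=(\infty,1)$ and $(1,\infty)$ are allowed,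 with $\frac{2(q-1)}{q}$ read as $2$ for $q=\infty$. If $i=n$, then $K_{in}=-1$ and the only polynomial kernel is the zero polynomial. Suprema and infima are taken in $[0,\infty]$. *)

theory Defs
  imports "HOL-Analysis.Analysis" "Graph_Theory.Digraph_Component" "Graph_Theory.Pair_Digraph"
begin

text \<open>
  The vertex set is a finite type \<^typ>\<open>'n\<close>, so the number of vertices is
  \<^term>\<open>CARD('n::finite)\<close>. The edge set is determined by the weight matrix.
\<close>

definition graph_of :: "real^'n^'n \<Rightarrow> 'n pair_pre_digraph" where
  "graph_of W = \<lparr> pverts = UNIV, parcs = {(m, n). W $ m $ n > 0} \<rparr>"

definition connected_weighted_graph :: "real^'n^'n \<Rightarrow> bool" where
  "connected_weighted_graph W \<longleftrightarrow>
     (\<forall>m n. W $ m $ n \<ge> 0) \<and> (\<forall>m n. W $ m $ n = W $ n $ m) \<and> (\<forall>n. W $ n $ n = 0) \<and>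
     Digraph_Component.connected (with_proj (graph_of W))"

definition graph_dist :: "real^'n^'n \<Rightarrow> 'n \<Rightarrow> 'n \<Rightarrow> nat" where
  "graph_dist W i n =
     (LEAST k. \<exists>p. pre_digraph.apath (with_proj (graph_of W)) i p n \<and> length p = k)"

definition degree_matrix :: "real^'n^'n \<Rightarrow> real^'n^'n" where
  "degree_matrix W = (\<chi> i j. if i = j then (\<Sum>m\<in>UNIV - {i}. W $ m $ i) else 0)"

definition laplacian :: "real^'n^'n \<Rightarrow> real^'n^'n" where
  "laplacian W = degree_matrix W - W"

definition herm_inner :: "complex^'n \<Rightarrow> complex^'n \<Rightarrow> complex" where
  "herm_inner x y = (\<Sum>j\<in>UNIV. x $ j * cnj (y $ j))"

text \<open>
  Below, \<^term>\<open>u l\<close> is the eigenvector and \<^term>\<open>ev l\<close> the eigenvalue with index \<^term>\<open>l\<close>,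
  where only indices \<^prop>\<open>l < CARD('n::finite)\<close> are relevant. The constant
  \<^term>\<open>vec.span\<close> is the complex linear span (plain \<^term>\<open>span\<close> would be the real one).
\<close>

definition laplacian_eigenbasis ::
    "real^'n^'n \<Rightarrow> (nat \<Rightarrow> real) \<Rightarrow> (nat \<Rightarrow> complex^'n) \<Rightarrow> bool" where
  "laplacian_eigenbasis W ev u \<longleftrightarrow>
     (\<forall>l<CARD('n). \<forall>m<CARD('n). herm_inner (u l) (u m) = (if l = m then 1 else 0)) \<and>
     vec.span (u ` {..<CARD('n)}) = UNIV \<and>
     (\<forall>l<CARD('n). map_matrix complex_of_real (laplacian W) *v u l = complex_of_real (ev l) *s u l) \<and>
     ev 0 = 0 \<and> (\<forall>l. 0 < l \<and> l < CARD('n) \<longrightarrow> 0 < ev l) \<and>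
     (\<forall>l m. l \<le> m \<and> m < CARD('n) \<longrightarrow> ev l \<le> ev m) \<and>
     (\<forall>n. u 0 $ n = complex_of_real (1 / sqrt (real CARD('n))))"

definition coherence :: "(nat \<Rightarrow> complex^'n) \<Rightarrow> real" where
  "coherence u = Max {cmod (u l $ i) | l i. l < CARD('n)}"

definition gen_translation ::
    "(nat \<Rightarrow> real) \<Rightarrow> (nat \<Rightarrow> complex^'n) \<Rightarrow> (real \<Rightarrow> real) \<Rightarrow> 'n \<Rightarrow> complex^'n" where
  "gen_translation ev u ghat i = (\<chi> n. complex_of_real (sqrt (real CARD('n))) *
     (\<Sum>l<CARD('n). complex_of_real (ghat (ev l)) * cnj (u l $ i) * u l $ n))"

text \<open>
  The index \<^term>\<open>K\<close> is an integer, so that \<^prop>\<open>K = -1\<close> leaves only the zero polynomial.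
\<close>

definition poly_kernels :: "int \<Rightarrow> (real \<Rightarrow> real) set" where
  "poly_kernels K = {\<lambda>x. (\<Sum>k | int k \<le> K. a k * x ^ k) | a :: nat \<Rightarrow> real. True}"

lemma poly_kernels_minus_one: "poly_kernels (-1) = {\<lambda>x. 0}"
  by (auto simp: poly_kernels_def)

lemma poly_kernels_nat:
  "poly_kernels (int K) = {\<lambda>x. (\<Sum>k=0..K. a k * x ^ k) | a :: nat \<Rightarrow> real. True}"
proof -
  have "{k. int k \<le> int K} = {0..K}" by auto
  then show ?thesis by (simp add: poly_kernels_def)
qed

text \<open>
  Kernels are total functions, of which only the values on the interval from \<^term>\<open>0\<close> to
  \<^term>\<open>ev (N - 1)\<close> are used. They may be unbounded there, whence the norms take values in
  \<^typ>\<open>ennreal\<close>.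
\<close>

definition sup_norm :: "nat \<Rightarrow> (nat \<Rightarrow> real) \<Rightarrow> (real \<Rightarrow> real) \<Rightarrow> ennreal" where
  "sup_norm N ev h = (SUP x\<in>{0..ev (N - 1)}. ennreal \<bar>h x\<bar>)"

definition kernel_norm :: "nat \<Rightarrow> (nat \<Rightarrow> real) \<Rightarrow> ennreal \<Rightarrow> (real \<Rightarrow> real) \<Rightarrow> ennreal" where
  "kernel_norm N ev p h =
     (if p = top then sup_norm N ev h
      else ennreal ((\<Sum>l<N. \<bar>h (ev l)\<bar> powr enn2real p) powr (1 / enn2real p)))"

text \<open>The exponent \<open>2 (q - 1) / q\<close>, with value \<^term>\<open>2::real\<close> for infinite \<^term>\<open>q\<close>.\<close>

definition coherence_exponent :: "ennreal \<Rightarrow> real" where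
  "coherence_exponent q = (if q = top then 2 else 2 * (enn2real q - 1) / enn2real q)"

end

theory Submission
  imports Defs
begin

text \<open>
  Write \<open>N\<close> for the number of vertices. Up to the factor \<open>sqrt N\<close>, the value of the
  translate of a kernel \<open>f\<close> at \<open>n\<close> is the \<open>(n, i)\<close> entry of the matrix \<open>f(L)\<close>,
  where \<open>L\<close> is the Laplacian. An entry \<open>(n, m)\<close> of \<open>L\<close> with
  \<open>n \<noteq> m\<close> vanishes unless \<open>n\<close> and \<open>m\<close> are adjacent, so the \<open>(n, i)\<close> entry of
  \<open>L\<^sup>k\<close> vanishes unless some path from \<open>i\<close> to \<open>n\<close> has at most \<open>k\<close> edges
  (\<open>spectral_power_entry_local\<close>). Hence a polynomial kernel whose degree is less than the distance
  between \<open>i\<close> and \<open>n\<close> contributes nothing, and any such kernel can be subtracted from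
  \<open>ghat\<close> without changing the translate at \<open>n\<close>
  (\<open>gen_translation_diff_poly_kernel\<close>).

  It remains to bound the translate of an arbitrary kernel \<open>f\<close>. The triangle inequality bounds it
  by \<open>sqrt N\<close> times the sum of the \<open>\<bar>f (ev l)\<bar>\<close>, with the weight at \<open>l\<close> equal to
  the product of the absolute values of \<open>u l\<close> at \<open>i\<close> and at \<open>n\<close>.
  The weights have sum at most \<open>1\<close>, because the values of the
  eigenvectors at a single vertex form a unit vector, and no weight exceeds the square of the coherence
  \<open>\<mu>\<close>. The first fact gives the bound for \<open>p = \<infinity>\<close>, the second the one for
  \<open>p = 1\<close>; for other \<open>p\<close> the Hoelder inequality combines them, since the
  \<open>q\<close>-th powers of the weights have sum at most \<open>\<mu>\<close> to the power \<open>2 (q - 1)\<close>.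
\<close>

section \<open>Inequalities for finite sums and for infima\<close>

text \<open>
  After both factors have been scaled to norm one, Young's inequality bounds each product, and the
  bounds add up to \<open>1 / p + 1 / q = 1\<close>.
\<close>
lemma Holder_inequality_sum:
  fixes a b :: "'a \<Rightarrow> real"
  assumes fin: "finite A" and p: "p > 1" and q: "q > 1" and pq: "1 / p + 1 / q = 1"
    and a: "\<And>x. x \<in> A \<Longrightarrow> a x \<ge> 0" and b: "\<And>x. x \<in> A \<Longrightarrow> b x \<ge> 0"
  shows "(\<Sum>x\<in>A. a x * b x)
    \<le> (\<Sum>x\<in>A. a x powr p) powr (1 / p) * (\<Sum>x\<in>A. b x powr q) powr (1 / q)"
proof -
  define S where "S = (\<Sum>x\<in>A. a x powr p)"
  define T where "T = (\<Sum>x\<in>A. b x powr q)"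
  have S0: "S \<ge> 0" and T0: "T \<ge> 0" by (auto simp: S_def T_def intro: sum_nonneg)
  show ?thesis
  proof (cases "S = 0 \<or> T = 0")
    case True
    then have "a x * b x = 0" if "x \<in> A" for x
    proof
      assume "S = 0"
      then have "a x powr p = 0"
        using fin that by (simp add: S_def sum_nonneg_eq_0_iff)
      then show ?thesis by simp
    next
      assume "T = 0"
      then have "b x powr q = 0"
        using fin that by (simp add: T_def sum_nonneg_eq_0_iff)
      then show ?thesis by simp
    qed
    then have "(\<Sum>x\<in>A. a x * b x) = 0" by (intro sum.neutral) blast
    then show ?thesis by simp
  next
    case False
    then have S: "S > 0" and T: "T > 0" using S0 T0 by auto
    define s where "s = S powr (1 / p)"
    define t where "t = T powr (1 / q)"
    have s: "s > 0" "s powr p = S" and t: "t > 0" "t powr q = T"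
      using S T p q by (auto simp: s_def t_def powr_powr)
    have "(\<Sum>x\<in>A. (a x / s) * (b x / t))
        \<le> (\<Sum>x\<in>A. (a x / s) powr p / p + (b x / t) powr q / q)"
      using a b s t p q pq by (intro sum_mono Youngs_inequality) auto
    also have "\<dots> = (\<Sum>x\<in>A. a x powr p / S / p + b x powr q / T / q)"
      using a b s t by (intro sum.cong) (auto simp: powr_divide)
    also have "\<dots> = (\<Sum>x\<in>A. a x powr p) / S / p + (\<Sum>x\<in>A. b x powr q) / T / q"
      by (simp only: sum.distrib sum_divide_distrib)
    also have "\<dots> = S / S / p + T / T / q" by (simp only: S_def T_def)
    also have "\<dots> = 1" using S T pq by simp
    finally have "(\<Sum>x\<in>A. a x * b x) / (s * t) \<le> 1"
      by (simp add: sum_divide_distrib)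
    then show ?thesis using s t by (simp add: divide_le_eq S_def T_def s_def t_def)
  qed
qed

text \<open>
  Reduces a bound by an infimum in \<open>[0, \<infinity>]\<close> to real inequalities. Where \<open>F\<close> is infinite
  there is nothing to show; elsewhere, dividing by \<open>c\<close> turns the hypothesis into the lower bound
  \<open>x / c\<close> for \<open>F\<close>.
\<close>
lemma ennreal_le_mult_INF:
  fixes F :: "'a \<Rightarrow> ennreal"
  assumes c: "c > 0"
    and le: "\<And>h y. h \<in> A \<Longrightarrow> y \<ge> 0 \<Longrightarrow> F h = ennreal y \<Longrightarrow> x \<le> c * y"
  shows "ennreal x \<le> ennreal c * (INF h\<in>A. F h)"
proof -
  have "ennreal (x / c) \<le> F h" if "h \<in> A" for h
  proof (cases "F h")
    case (real y)
    then show ?thesis using le[OF that, of y] c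
      by (auto intro!: ennreal_leI simp: divide_le_eq mult.commute)
  qed simp
  then have "ennreal c * ennreal (x / c) \<le> ennreal c * (INF h\<in>A. F h)"
    by (intro mult_left_mono INF_greatest) auto
  then show ?thesis using c by (simp flip: ennreal_mult')
qed

section \<open>Paths and the graph distance\<close>

lemma (in wf_digraph) length_awalk_to_apath_le:
  assumes "awalk u p v"
  shows "length (awalk_to_apath p) \<le> length p"
  using assms
proof (induct rule: awalk_to_apath_induct)
  case (path p)
  then have "awalk_to_apath p = p"
    by (auto simp: awalk_to_apath.simps)
  then show ?case by simp
next
  case (decomp p q r s)
  then have "length (q @ s) \<le> length p"
    by (auto elim!: awalk_cyc_decompE)
  then show ?case
    using decomp step_awalk_to_apath[of _ p _ q r s] by simp
qed

lemma wf_digraph_graph_of: "wf_digraph (with_proj (graph_of W))"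
  by unfold_locales (auto simp: graph_of_def)

text \<open>
  The distance is the least length of a path without repeated vertices; cutting the cycles out of a
  walk gives such a path that is no longer.
\<close>
lemma graph_dist_le_length_awalk:
  assumes "pre_digraph.awalk (with_proj (graph_of W)) i p n"
  shows "graph_dist W i n \<le> length p"
proof -
  interpret wf_digraph "with_proj (graph_of W)" by (rule wf_digraph_graph_of)
  have "graph_dist W i n \<le> length (awalk_to_apath p)"
    unfolding graph_dist_def using apath_awalk_to_apath[OF assms] by (intro Least_le) blast
  also have "\<dots> \<le> length p" by (rule length_awalk_to_apath_le[OF assms])
  finally show ?thesis .
qed

section \<open>Orthonormal eigenbases of the Laplacian\<close>

text \<open>
  Expand the standard basis vector at \<open>i\<close> in the orthonormal basis \<open>u\<close> and read off the
  coordinate at \<open>n\<close>.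
\<close>
lemma eigenbasis_completeness:
  fixes u :: "nat \<Rightarrow> complex^'n"
  assumes "laplacian_eigenbasis W ev u"
  shows "(\<Sum>l<CARD('n). cnj (u l $ i) * u l $ n) = (if n = i then 1 else 0)"
proof -
  let ?P = "\<lambda>x. x = (\<Sum>l<CARD('n). herm_inner x (u l) *s u l)"
  have orth: "herm_inner (u l) (u m) = (if l = m then 1 else 0)"
    if "l < CARD('n)" "m < CARD('n)" for l m
    using assms that by (auto simp: laplacian_eigenbasis_def)
  have span: "vec.span (u ` {..<CARD('n)}) = UNIV"
    using assms by (simp add: laplacian_eigenbasis_def)
  have add: "herm_inner (x + y) z = herm_inner x z + herm_inner y z" for x y z :: "complex^'n"
    by (simp add: herm_inner_def ring_distribs sum.distrib)
  have scale: "herm_inner (c *s x) z = c * herm_inner x z" for c and x z :: "complex^'n"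
    by (simp add: herm_inner_def sum_distrib_left mult.assoc)
  have "vec.subspace {x. ?P x}"
  proof (rule vec.subspaceI)
    show "0 \<in> {x. ?P x}" by (simp add: herm_inner_def)
  next
    fix x y assume "x \<in> {x. ?P x}" "y \<in> {x. ?P x}"
    then have "?P x" "?P y" by auto
    then have "x + y = (\<Sum>l<CARD('n). herm_inner x (u l) *s u l)
        + (\<Sum>l<CARD('n). herm_inner y (u l) *s u l)"
      by argo
    also have "\<dots> = (\<Sum>l<CARD('n). herm_inner (x + y) (u l) *s u l)"
      by (simp add: add vec.scale_left_distrib sum.distrib)
    finally show "x + y \<in> {x. ?P x}" by simp
  next
    fix c x assume "x \<in> {x. ?P x}"
    then have "c *s x = c *s (\<Sum>l<CARD('n). herm_inner x (u l) *s u l)"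
      by auto
    also have "\<dots> = (\<Sum>l<CARD('n). herm_inner (c *s x) (u l) *s u l)"
      by (simp add: scale vec.scale_sum_right)
    finally show "c *s x \<in> {x. ?P x}" by simp
  qed
  moreover have "u ` {..<CARD('n)} \<subseteq> {x. ?P x}"
  proof safe
    fix m assume m: "m < CARD('n)"
    have "(\<Sum>l<CARD('n). herm_inner (u m) (u l) *s u l)
        = (\<Sum>l<CARD('n). if l = m then u m else 0)"
      using m orth by (intro sum.cong) auto
    then show "?P (u m)" using m by simp
  qed
  ultimately have "vec.span (u ` {..<CARD('n)}) \<subseteq> {x. ?P x}"
    by (intro vec.span_minimal)
  then have "?P (axis i 1)" unfolding span by blast
  moreover have "herm_inner (axis i 1) (u l) = cnj (u l $ i)" for l
    by (simp add: herm_inner_def axis_def if_distrib[of "\<lambda>x. x * _"] cong: if_cong)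
  ultimately have "(axis i 1 :: complex^'n) = (\<Sum>l<CARD('n). cnj (u l $ i) *s u l)"
    by simp
  then have "(axis i 1 :: complex^'n) $ n = (\<Sum>l<CARD('n). cnj (u l $ i) *s u l) $ n"
    by simp
  then show ?thesis
    by (auto simp: sum_component axis_def)
qed

lemma eigenbasis_vertex_norm:
  fixes u :: "nat \<Rightarrow> complex^'n"
  assumes "laplacian_eigenbasis W ev u"
  shows "(\<Sum>l<CARD('n). (cmod (u l $ i))\<^sup>2) = 1"
proof -
  have "complex_of_real (\<Sum>l<CARD('n). (cmod (u l $ i))\<^sup>2)
      = (\<Sum>l<CARD('n). cnj (u l $ i) * u l $ i)"
    unfolding of_real_sum by (intro sum.cong) (auto simp: complex_norm_square mult.commute simp del: of_real_power)
  also have "\<dots> = complex_of_real 1"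
    using eigenbasis_completeness[OF assms, of i i] by simp
  finally show ?thesis by (simp only: of_real_eq_iff)
qed

lemma eigenbasis_weight_sum_le_1:
  fixes u :: "nat \<Rightarrow> complex^'n"
  assumes "laplacian_eigenbasis W ev u"
  shows "(\<Sum>l<CARD('n). cmod (u l $ i) * cmod (u l $ n)) \<le> 1"
proof -
  have "(\<Sum>l<CARD('n). cmod (u l $ i) * cmod (u l $ n))
      \<le> (\<Sum>l<CARD('n). ((cmod (u l $ i))\<^sup>2 + (cmod (u l $ n))\<^sup>2) / 2)"
  proof (rule sum_mono)
    fix l
    have "0 \<le> (cmod (u l $ i) - cmod (u l $ n))\<^sup>2" by simp
    then show "cmod (u l $ i) * cmod (u l $ n) \<le> ((cmod (u l $ i))\<^sup>2 + (cmod (u l $ n))\<^sup>2) / 2"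
      unfolding power2_diff by simp
  qed
  also have "\<dots> = 1"
    by (simp add: sum.distrib eigenbasis_vertex_norm[OF assms] flip: sum_divide_distrib)
  finally show ?thesis .
qed

lemma cmod_le_coherence:
  fixes u :: "nat \<Rightarrow> complex^'n"
  assumes "l < CARD('n)"
  shows "cmod (u l $ i) \<le> coherence u"
proof -
  have "{cmod (u l $ i) | l i. l < CARD('n)} = (\<lambda>(l, i). cmod (u l $ i)) ` ({..<CARD('n)} \<times> UNIV)"
    by auto
  then have "finite {cmod (u l $ i) | l i. l < CARD('n)}" by simp
  then show ?thesis unfolding coherence_def using assms by (intro Max_ge) auto
qed

lemma coherence_pos:
  fixes u :: "nat \<Rightarrow> complex^'n"
  assumes "laplacian_eigenbasis W ev u"
  shows "coherence u > 0"
proof -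
  fix i :: 'n
  have "u 0 $ i = complex_of_real (1 / sqrt (real CARD('n)))"
    using assms unfolding laplacian_eigenbasis_def by blast
  then have "cmod (u 0 $ i) = 1 / sqrt (real CARD('n))"
    by (simp only: norm_of_real) simp
  then have "0 < cmod (u 0 $ i)" by simp
  also have "\<dots> \<le> coherence u" by (rule cmod_le_coherence) simp
  finally show ?thesis .
qed

section \<open>Polynomial kernels of low degree\<close>

lemma laplacian_eigenvector_component:
  fixes u :: "nat \<Rightarrow> complex^'n"
  assumes "laplacian_eigenbasis W ev u" and "l < CARD('n)"
  shows "complex_of_real (ev l) * u l $ n
    = (\<Sum>m\<in>UNIV. complex_of_real (laplacian W $ n $ m) * u l $ m)"
proof -
  have "(map_matrix complex_of_real (laplacian W) *v u l) $ n = (complex_of_real (ev l) *s u l) $ n"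
    using assms by (simp add: laplacian_eigenbasis_def)
  then show ?thesis by (simp add: matrix_vector_mult_def map_matrix_def)
qed

lemma laplacian_adjacent:
  assumes "connected_weighted_graph W" and "laplacian W $ n $ m \<noteq> 0" and "m \<noteq> n"
  shows "W $ m $ n > 0"
  using assms
  by (auto simp: laplacian_def degree_matrix_def connected_weighted_graph_def less_le)

text \<open>
  The sum is the \<open>(n, i)\<close> entry of the \<open>k\<close>-th power of the Laplacian, by its spectral
  decomposition. Each further factor, by the eigenvalue equation, replaces the entry at \<open>n\<close> by a
  combination of the entries at \<open>n\<close> and at its neighbours, so the support grows by at most one
  edge.
\<close>
lemma spectral_power_entry_local:
  fixes u :: "nat \<Rightarrow> complex^'n"
  assumes W: "connected_weighted_graph W" and u: "laplacian_eigenbasis W ev u"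
    and nz: "(\<Sum>l<CARD('n). complex_of_real (ev l) ^ k * cnj (u l $ i) * u l $ n) \<noteq> 0"
  shows "\<exists>p. pre_digraph.awalk (with_proj (graph_of W)) i p n \<and> length p \<le> k"
  using nz
proof (induction k arbitrary: n)
  case 0
  interpret wf_digraph "with_proj (graph_of W)" by (rule wf_digraph_graph_of)
  have "n = i"
    using 0 eigenbasis_completeness[OF u, of i n] by (auto split: if_splits)
  then have "awalk i [] n"
    unfolding awalk_Nil_iff by (simp add: graph_of_def)
  then show ?case by auto
next
  case (Suc k)
  interpret wf_digraph "with_proj (graph_of W)" by (rule wf_digraph_graph_of)
  let ?S = "\<lambda>k n. \<Sum>l<CARD('n). complex_of_real (ev l) ^ k * cnj (u l $ i) * u l $ n"
  have "?S (Suc k) n = (\<Sum>l<CARD('n). \<Sum>m\<in>UNIV. complex_of_real (laplacian W $ n $ m) *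
      (complex_of_real (ev l) ^ k * cnj (u l $ i) * u l $ m))"
  proof (rule sum.cong[OF refl])
    fix l assume "l \<in> {..<CARD('n)}"
    then have l: "l < CARD('n)" by simp
    have "complex_of_real (ev l) ^ Suc k * cnj (u l $ i) * u l $ n
        = (complex_of_real (ev l) ^ k * cnj (u l $ i)) * (complex_of_real (ev l) * u l $ n)"
      by simp
    then show "complex_of_real (ev l) ^ Suc k * cnj (u l $ i) * u l $ n
      = (\<Sum>m\<in>UNIV. complex_of_real (laplacian W $ n $ m) *
        (complex_of_real (ev l) ^ k * cnj (u l $ i) * u l $ m))"
      unfolding laplacian_eigenvector_component[OF u l] by (simp add: sum_distrib_left mult_ac)
  qed
  also have "\<dots> = (\<Sum>m\<in>UNIV. complex_of_real (laplacian W $ n $ m) * ?S k m)"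
    by (subst sum.swap) (simp add: sum_distrib_left)
  finally have "(\<Sum>m\<in>UNIV. complex_of_real (laplacian W $ n $ m) * ?S k m) \<noteq> 0"
    using Suc.prems by simp
  then obtain m where "complex_of_real (laplacian W $ n $ m) * ?S k m \<noteq> 0"
    by (meson sum.neutral)
  then have L: "laplacian W $ n $ m \<noteq> 0" and S: "?S k m \<noteq> 0" by auto
  obtain p where p: "awalk i p m" "length p \<le> k" using Suc.IH[OF S] by blast
  show ?case
  proof (cases "m = n")
    case True
    then show ?thesis using p by (intro exI[of _ p]) auto
  next
    case False
    then have "W $ m $ n > 0" using laplacian_adjacent[OF W L] by simp
    then have "awalk m [(m, n)] n"
      using arc_implies_awalk[of "(m, n)"] by (simp add: graph_of_def)
    then have "awalk i (p @ [(m, n)]) n" using p(1) by (rule awalk_appendI[rotated])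
    then show ?thesis using p(2) by (intro exI[of _ "p @ [(m, n)]"]) auto
  qed
qed

lemma gen_translation_poly_kernel_eq_0:
  fixes u :: "nat \<Rightarrow> complex^'n"
  assumes W: "connected_weighted_graph W" and u: "laplacian_eigenbasis W ev u"
    and h: "h \<in> poly_kernels (int (graph_dist W i n) - 1)"
  shows "gen_translation ev u h i $ n = 0"
proof -
  let ?A = "{k. int k \<le> int (graph_dist W i n) - 1}"
  obtain a where a: "h = (\<lambda>x. \<Sum>k\<in>?A. a k * x ^ k)"
    using h by (auto simp: poly_kernels_def)
  have zero: "(\<Sum>l<CARD('n). complex_of_real (ev l) ^ k * cnj (u l $ i) * u l $ n) = 0"
    if "k \<in> ?A" for k
    using spectral_power_entry_local[OF W u, of k i n] graph_dist_le_length_awalk[of W i _ n] that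
    by fastforce
  have "(\<Sum>l<CARD('n). complex_of_real (h (ev l)) * cnj (u l $ i) * u l $ n)
      = (\<Sum>l<CARD('n). \<Sum>k\<in>?A. complex_of_real (a k) *
          (complex_of_real (ev l) ^ k * cnj (u l $ i) * u l $ n))"
    by (simp add: a sum_distrib_right mult.assoc)
  also have "\<dots> = (\<Sum>k\<in>?A. complex_of_real (a k) *
      (\<Sum>l<CARD('n). complex_of_real (ev l) ^ k * cnj (u l $ i) * u l $ n))"
    by (subst sum.swap) (simp add: sum_distrib_left)
  also have "\<dots> = 0" by (rule sum.neutral) (simp add: zero)
  finally show ?thesis by (simp add: gen_translation_def)
qed

lemma gen_translation_diff_poly_kernel:
  fixes u :: "nat \<Rightarrow> complex^'n"
  assumes "connected_weighted_graph W" and "laplacian_eigenbasis W ev u"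
    and "h \<in> poly_kernels (int (graph_dist W i n) - 1)"
  shows "gen_translation ev u (\<lambda>x. g x - h x) i $ n = gen_translation ev u g i $ n"
proof -
  have "gen_translation ev u (\<lambda>x. g x - h x) i $ n
      = gen_translation ev u g i $ n - gen_translation ev u h i $ n"
    by (simp add: gen_translation_def left_diff_distrib right_diff_distrib sum_subtractf)
  then show ?thesis using gen_translation_poly_kernel_eq_0[OF assms] by simp
qed

section \<open>Bounds for the translate of an arbitrary kernel\<close>

lemma gen_translation_weighted_bound:
  fixes u :: "nat \<Rightarrow> complex^'n"
  shows "cmod (gen_translation ev u f i $ n)
    \<le> sqrt (real CARD('n)) * (\<Sum>l<CARD('n). \<bar>f (ev l)\<bar> * (cmod (u l $ i) * cmod (u l $ n)))"
proof -
  have "cmod (\<Sum>l<CARD('n). complex_of_real (f (ev l)) * cnj (u l $ i) * u l $ n)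
      \<le> (\<Sum>l<CARD('n). \<bar>f (ev l)\<bar> * (cmod (u l $ i) * cmod (u l $ n)))"
    by (rule order_trans[OF norm_sum]) (simp add: norm_mult mult.assoc)
  then show ?thesis
    by (simp add: gen_translation_def norm_mult mult_left_mono)
qed

lemma gen_translation_sup_bound:
  fixes u :: "nat \<Rightarrow> complex^'n"
  assumes u: "laplacian_eigenbasis W ev u" and s: "s \<ge> 0"
    and f: "\<And>x. x \<in> {0..ev (CARD('n) - 1)} \<Longrightarrow> \<bar>f x\<bar> \<le> s"
  shows "cmod (gen_translation ev u f i $ n) \<le> sqrt (real CARD('n)) * s"
proof -
  have mono: "ev l \<le> ev m" if "l \<le> m" "m < CARD('n)" for l m
    using u that by (auto simp: laplacian_eigenbasis_def)
  have "ev 0 = 0" using u by (auto simp: laplacian_eigenbasis_def)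
  then have range: "ev l \<in> {0..ev (CARD('n) - 1)}" if "l < CARD('n)" for l
    using mono[of 0 l] mono[of l "CARD('n) - 1"] that by auto
  have "(\<Sum>l<CARD('n). \<bar>f (ev l)\<bar> * (cmod (u l $ i) * cmod (u l $ n)))
      \<le> (\<Sum>l<CARD('n). s * (cmod (u l $ i) * cmod (u l $ n)))"
    using f range by (intro sum_mono mult_right_mono) auto
  also have "\<dots> = s * (\<Sum>l<CARD('n). cmod (u l $ i) * cmod (u l $ n))"
    by (simp add: sum_distrib_left)
  also have "\<dots> \<le> s * 1"
    using s eigenbasis_weight_sum_le_1[OF u] by (intro mult_left_mono) auto
  finally show ?thesis
    using gen_translation_weighted_bound[of ev u f i n]
    by (auto intro: order_trans mult_left_mono)
qed

lemma gen_translation_1_bound: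
  fixes u :: "nat \<Rightarrow> complex^'n"
  assumes u: "laplacian_eigenbasis W ev u"
  shows "cmod (gen_translation ev u f i $ n)
    \<le> sqrt (real CARD('n)) * (coherence u powr 2 * (\<Sum>l<CARD('n). \<bar>f (ev l)\<bar>))"
proof -
  have "(\<Sum>l<CARD('n). \<bar>f (ev l)\<bar> * (cmod (u l $ i) * cmod (u l $ n)))
      \<le> (\<Sum>l<CARD('n). \<bar>f (ev l)\<bar> * (coherence u * coherence u))"
    using coherence_pos[OF u]
    by (intro sum_mono mult_left_mono mult_mono cmod_le_coherence) auto
  also have "\<dots> = coherence u powr 2 * (\<Sum>l<CARD('n). \<bar>f (ev l)\<bar>)"
    using coherence_pos[OF u] by (simp add: power2_eq_square mult.commute flip: sum_distrib_right)
  finally show ?thesis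
    using gen_translation_weighted_bound[of ev u f i n]
    by (auto intro: order_trans mult_left_mono)
qed

text \<open>
  Of the \<open>q\<close> factors of a \<open>q\<close>-th power of a weight, \<open>q - 1\<close> are bounded by
  \<open>\<mu>\<^sup>2\<close>, and the last one is kept, because the sum of the weights is at most \<open>1\<close>.
\<close>
lemma eigenbasis_weight_powr_sum_le:
  fixes u :: "nat \<Rightarrow> complex^'n"
  assumes u: "laplacian_eigenbasis W ev u" and q: "q > 1"
  shows "(\<Sum>l<CARD('n). (cmod (u l $ i) * cmod (u l $ n)) powr q) \<le> coherence u powr (2 * (q - 1))"
proof -
  let ?w = "\<lambda>l. cmod (u l $ i) * cmod (u l $ n)"
  have \<mu>: "coherence u > 0" by (rule coherence_pos[OF u])
  have "(\<Sum>l<CARD('n). ?w l powr q) \<le> (\<Sum>l<CARD('n). coherence u powr (2 * (q - 1)) * ?w l)"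
  proof (rule sum_mono)
    fix l assume "l \<in> {..<CARD('n)}"
    then have "?w l \<le> coherence u * coherence u"
      using \<mu> by (intro mult_mono cmod_le_coherence) auto
    also have "\<dots> = coherence u powr 2" using \<mu> by (simp add: power2_eq_square)
    finally have "?w l powr (q - 1) \<le> (coherence u powr 2) powr (q - 1)"
      using q by (intro powr_mono2) auto
    then have "?w l powr (q - 1) * ?w l \<le> coherence u powr (2 * (q - 1)) * ?w l"
      by (intro mult_right_mono) (auto simp: powr_powr)
    moreover have "?w l powr q = ?w l powr (q - 1) * ?w l"
      using powr_mult_base[of "?w l" "q - 1"] by (simp add: mult.commute)
    ultimately show "?w l powr q \<le> coherence u powr (2 * (q - 1)) * ?w l" by simp
  qed
  also have "\<dots> = coherence u powr (2 * (q - 1)) * (\<Sum>l<CARD('n). ?w l)"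
    by (simp add: sum_distrib_left)
  also have "\<dots> \<le> coherence u powr (2 * (q - 1)) * 1"
    using eigenbasis_weight_sum_le_1[OF u] by (intro mult_left_mono) auto
  finally show ?thesis by simp
qed

lemma gen_translation_Holder_bound:
  fixes u :: "nat \<Rightarrow> complex^'n"
  assumes u: "laplacian_eigenbasis W ev u"
    and p: "p > 1" and q: "q > 1" and pq: "1 / p + 1 / q = 1"
  shows "cmod (gen_translation ev u f i $ n) \<le> sqrt (real CARD('n)) *
    (coherence u powr (2 * (q - 1) / q) * (\<Sum>l<CARD('n). \<bar>f (ev l)\<bar> powr p) powr (1 / p))"
proof -
  let ?w = "\<lambda>l. cmod (u l $ i) * cmod (u l $ n)"
  have "(\<Sum>l<CARD('n). ?w l powr q) powr (1 / q) \<le> (coherence u powr (2 * (q - 1))) powr (1 / q)"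
    using eigenbasis_weight_powr_sum_le[OF u q] q by (intro powr_mono2 sum_nonneg) auto
  then have w: "(\<Sum>l<CARD('n). ?w l powr q) powr (1 / q) \<le> coherence u powr (2 * (q - 1) / q)"
    by (simp add: powr_powr)
  have "(\<Sum>l<CARD('n). \<bar>f (ev l)\<bar> * ?w l)
      \<le> (\<Sum>l<CARD('n). \<bar>f (ev l)\<bar> powr p) powr (1 / p) * (\<Sum>l<CARD('n). ?w l powr q) powr (1 / q)"
    by (rule Holder_inequality_sum) (use p q pq in auto)
  also have "\<dots> \<le> (\<Sum>l<CARD('n). \<bar>f (ev l)\<bar> powr p) powr (1 / p) * coherence u powr (2 * (q - 1) / q)"
    by (intro mult_left_mono w) auto
  finally have "(\<Sum>l<CARD('n). \<bar>f (ev l)\<bar> * ?w l)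
      \<le> coherence u powr (2 * (q - 1) / q) * (\<Sum>l<CARD('n). \<bar>f (ev l)\<bar> powr p) powr (1 / p)"
    by (simp add: mult.commute)
  then show ?thesis
    using gen_translation_weighted_bound[of ev u f i n]
    by (auto intro: order_trans mult_left_mono)
qed

lemma conjugate_exponents_cases:
  fixes p q :: ennreal
  assumes "1 \<le> p" "1 \<le> q" "1 / p + 1 / q = 1"
  obtains (top) "p = top" "q = 1"
    | (one) "p = 1" "q = top"
    | (finite) p' q' where "p = ennreal p'" "q = ennreal q'" "1 < p'" "1 < q'" "1 / p' + 1 / q' = 1"
proof (cases p)
  case top
  then have "1 / q = 1" using assms by simp
  moreover from this have "q \<noteq> 0" "q \<noteq> top" by auto
  ultimately have "q = 1" by (metis ennreal_divide_times mult_1 mult.right_neutral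
      ennreal_divide_self divide_eq_1_ennreal top.not_eq_extremum zero_less_iff_neq_zero)
  then show thesis using top that(1) by simp
next
  case (real p')
  have p': "p' \<ge> 1" using real assms(1) by (simp flip: ennreal_1)
  have ip: "1 / p = ennreal (1 / p')"
    using p' real by (simp add: divide_ennreal flip: ennreal_1)
  show thesis
  proof (cases q)
    case top
    then have "ennreal (1 / p') = ennreal 1" using assms(3) ip by simp
    then have "p' = 1" using p' by (simp del: ennreal_1)
    then show thesis using top real that(2) by simp
  next
    case (real q')
    have q': "q' \<ge> 1" using real assms(2) by (simp flip: ennreal_1)
    have "1 / q = ennreal (1 / q')"
      using q' real by (simp add: divide_ennreal flip: ennreal_1)
    then have "ennreal (1 / p' + 1 / q') = ennreal 1"
      using assms(3) ip p' q' by simp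
    then have sum: "1 / p' + 1 / q' = 1" using p' q' by (simp del: ennreal_1 ennreal_plus)
    have "p' \<noteq> 1" "q' \<noteq> 1" using sum p' q' by auto
    then show thesis using that(3) \<open>p = ennreal p'\<close> real p' q' sum by auto
  qed
qed

theorem theorem1:
  fixes W :: "real^'n^'n" and ev :: "nat \<Rightarrow> real" and u :: "nat \<Rightarrow> complex^'n"
    and ghat :: "real \<Rightarrow> real" and i n :: 'n
  assumes "connected_weighted_graph W"
    and "laplacian_eigenbasis W ev u"
  shows "let N = CARD('n); K = int (graph_dist W i n) - 1 in
    ennreal (cmod (gen_translation ev u ghat i $ n))
      \<le> ennreal (sqrt (real N)) *
          (INF h\<in>poly_kernels K. SUP x\<in>{0..ev (N - 1)}. ennreal \<bar>ghat x - h x\<bar>) \<and>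
    ennreal (sqrt (real N)) *
          (INF h\<in>poly_kernels K. SUP x\<in>{0..ev (N - 1)}. ennreal \<bar>ghat x - h x\<bar>)
      = ennreal (sqrt (real N)) *
          (INF h\<in>poly_kernels K. kernel_norm N ev top (\<lambda>x. ghat x - h x)) \<and>
    (\<forall>p q :: ennreal. 1 \<le> p \<and> 1 \<le> q \<and> 1 / p + 1 / q = 1 \<longrightarrow>
      ennreal (cmod (gen_translation ev u ghat i $ n))
        \<le> ennreal (sqrt (real N)) * ennreal (coherence u powr coherence_exponent q) *
            (INF h\<in>poly_kernels K. kernel_norm N ev p (\<lambda>x. ghat x - h x)))"
proof -
  let ?N = "CARD('n)" and ?A = "poly_kernels (int (graph_dist W i n) - 1)"
  let ?T = "cmod (gen_translation ev u ghat i $ n)"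
  have N: "sqrt (real ?N) > 0" by simp
  have \<mu>: "coherence u > 0" by (rule coherence_pos[OF assms(2)])
  have shift: "?T = cmod (gen_translation ev u (\<lambda>x. ghat x - h x) i $ n)" if "h \<in> ?A" for h
    using gen_translation_diff_poly_kernel[OF assms that, of ghat] by simp
  have sup: "ennreal ?T \<le> ennreal (sqrt (real ?N)) *
      (INF h\<in>?A. SUP x\<in>{0..ev (?N - 1)}. ennreal \<bar>ghat x - h x\<bar>)"
  proof (rule ennreal_le_mult_INF[OF N])
    fix h y
    assume h: "h \<in> ?A" and y: "y \<ge> 0"
      and S: "(SUP x\<in>{0..ev (?N - 1)}. ennreal \<bar>ghat x - h x\<bar>) = ennreal y"
    have "\<bar>ghat x - h x\<bar> \<le> y" if "x \<in> {0..ev (?N - 1)}" for x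
    proof -
      have "ennreal \<bar>ghat x - h x\<bar> \<le> ennreal y"
        unfolding S[symmetric] using that by (rule SUP_upper)
      then show ?thesis using y by simp
    qed
    then show "?T \<le> sqrt (real ?N) * y"
      unfolding shift[OF h] by (intro gen_translation_sup_bound[OF assms(2) y])
  qed
  have pq: "ennreal ?T \<le> ennreal (sqrt (real ?N)) * ennreal (coherence u powr coherence_exponent q) *
      (INF h\<in>?A. kernel_norm ?N ev p (\<lambda>x. ghat x - h x))"
    if "1 \<le> p" "1 \<le> q" "1 / p + 1 / q = 1" for p q :: ennreal
    using that
  proof (cases rule: conjugate_exponents_cases)
    case top
    then show ?thesis using sup \<mu> by (simp add: coherence_exponent_def kernel_norm_def sup_norm_def)
  next
    case one
    have "ennreal ?T \<le> ennreal (sqrt (real ?N) * coherence u powr 2) *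
        (INF h\<in>?A. kernel_norm ?N ev 1 (\<lambda>x. ghat x - h x))"
    proof (rule ennreal_le_mult_INF)
      fix h y
      assume h: "h \<in> ?A" and "y \<ge> 0" and "kernel_norm ?N ev 1 (\<lambda>x. ghat x - h x) = ennreal y"
      then have "y = (\<Sum>l<?N. \<bar>ghat (ev l) - h (ev l)\<bar>)"
        by (simp add: kernel_norm_def sum_nonneg)
      then show "?T \<le> sqrt (real ?N) * coherence u powr 2 * y"
        unfolding shift[OF h]
        using gen_translation_1_bound[OF assms(2), of "\<lambda>x. ghat x - h x" i n]
        by (simp add: mult.assoc)
    qed (use N \<mu> in simp)
    then show ?thesis using one by (simp add: coherence_exponent_def ennreal_mult)
  next
    case (finite p' q')
    let ?\<mu> = "coherence u powr (2 * (q' - 1) / q')"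
    have "ennreal ?T \<le> ennreal (sqrt (real ?N) * ?\<mu>) *
        (INF h\<in>?A. kernel_norm ?N ev p (\<lambda>x. ghat x - h x))"
    proof (rule ennreal_le_mult_INF)
      fix h y
      assume h: "h \<in> ?A" and "y \<ge> 0" and "kernel_norm ?N ev p (\<lambda>x. ghat x - h x) = ennreal y"
      then have "y = (\<Sum>l<?N. \<bar>ghat (ev l) - h (ev l)\<bar> powr p') powr (1 / p')"
        using finite by (simp add: kernel_norm_def)
      then show "?T \<le> sqrt (real ?N) * ?\<mu> * y"
        unfolding shift[OF h]
        using gen_translation_Holder_bound[OF assms(2) finite(3-5), of "\<lambda>x. ghat x - h x" i n]
        by (simp add: mult.assoc)
    qed (use N \<mu> in simp)
    then show ?thesis using finite by (simp add: coherence_exponent_def ennreal_mult)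
  qed
  show ?thesis
    unfolding Let_def using sup pq by (simp add: kernel_norm_def sup_norm_def)
qed

end
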